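(* Let $H$ be a polarized integral Hodge structure of weight $2$ with polarization form $\langle\,,\rangle$, non trivial in the sense that $H^{2,0}\neq 0$. Assume that there is an associative unital ring structure on the lattice $H$ satisfying the following conditions: (1) The product $H\otimes H\to H$ is a morphism of Hodge structures of bidegree $(-1,-1)$. (2) There is an involutive endomorphism $t:H\to H$ such that for any $a\in H$, multiplication on the left (resp. on the right) by $t(a)$ is adjoint to multiplication on the left (resp. on the right) by $a$ with respect to $\langle\,,\rangle$, i.e. $\langle ax,y\rangle=\langle x,t(a)y\rangle$ and $\langle xa,y\rangle=\langle x,yt(a)\rangle$ for all $a,x,y\in H$. (3) The $t$-invariant part of the center of $H$ is $\mathbb{Z}$ (that is, $\mathbb{Z}\cdot 1$). Then there exists a unique weight $1$ Hodge structure on the lattice $H$ which is polarizable (or equivalently an abelian variety $A$ with $H=H_1(A,\mathbb{Z})$) such that multiplication on the left $$H\to \mathrm{Hom}(H,H),\qquad a\mapsto (x\mapsto ax),$$ is a morphism of Hodge structures, where the source carries the given weight $2$ Hodge structure and $\mathrm{Hom}(H,H)$ carries the weight $2$ Hodge structure induced by the weight $1$ Hodge structure on $H$.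
   Context: A polarized integral Hodge structure of weight $2$ is a lattice $H$ (free $\mathbb{Z}$-module of finite rank) with a decomposition $H_{\mathbb{C}}:=H\otimes\mathbb{C}=H^{2,0}\oplus H^{1,1}\oplus H^{0,2}$, $\overline{H^{2,0}}=H^{0,2}$, $\overline{H^{1,1}}=H^{1,1}$, and an integral symmetric bilinear form $\langle\,,\rangle$ such that the decomposition is orthogonal for the Hermitian form $h(\alpha,\beta)=\langle\alpha,\overline{\beta}\rangle$, and $h$ is positive definite on $H^{2,0}$ and on $H^{0,2}$ and negative definite on $H^{1,1}$. The product extends $\mathbb{C}$-bilinearly to $H_{\mathbb{C}}$. That it is a morphism of bidegree $(-1,-1)$ means $H^{p,q}\cdot H^{r,s}\subset H^{p+r-1,q+s-1}$, with $H^{p,q}=0$ unless $(p,q)\in\{(2,0),(1,1),(0,2)\}$. A weight $1$ Hodge structure on $H$ is a decomposition $H_{\mathbb{C}}=W'\oplus\overline{W'}$, with $W'$ the $(1,0)$-part. It is polarizable if there is a skew-symmetric integral bilinear form $\omega$ on $H$ (extended $\mathbb{C}$-bilinearly) for which $W'$ is totally isotropic and $(w,w')\mapsto i\omega(w,\overline{w'})$ is positive definite on $W'$; equivalently the complex torus $A=H_{\mathbb{C}}/(W'\oplus H)$ is an abelian variety. The weight $2$ Hodge structure induced on $\mathrm{Hom}(H,H)$ has $(2,0)$-part $\mathrm{Hom}(\overline{W'},W')$, $(1,1)$-part $\mathrm{Hom}(W',W')\oplus\mathrm{Hom}(\overline{W'},\overline{W'})$ and $(0,2)$-part $\mathrm{Hom}(W',\overline{W'})$.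 *)

theory Defs
  imports "HOL-Analysis.Analysis"
begin

text \<open>
  A lattice of rank \<open>n\<close> is represented as \<open>int ^ 'n\<close> with \<open>CARD('n) = n\<close>, and its
  complexification as \<open>complex ^ 'n\<close>, with \<open>of_lattice\<close> the map \<open>x \<mapsto> x \<otimes> 1\<close> and
  \<open>conj_vec\<close> the complex conjugation that fixes the lattice. The componentwise ring
  operations of \<open>int ^ 'n\<close> play no role: a product on the lattice is always an
  explicit function.
\<close>

definition of_lattice :: "int ^ 'n \<Rightarrow> complex ^ 'n" where
  "of_lattice x = (\<chi> i. of_int (x $ i))"

definition conj_vec :: "complex ^ 'n \<Rightarrow> complex ^ 'n" where
  "conj_vec v = (\<chi> i. cnj (v $ i))"

text \<open>For abelian groups, biadditive means \<open>\<int>\<close>-bilinear.\<close>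

definition biadditive :: "('a::ab_group_add \<Rightarrow> 'b::ab_group_add \<Rightarrow> 'c::ab_group_add) \<Rightarrow> bool" where
  "biadditive f \<longleftrightarrow> (\<forall>x. Modules.additive (f x)) \<and> (\<forall>y. Modules.additive (\<lambda>x. f x y))"

text \<open>
  The \<open>\<complex>\<close>-bilinear extensions of a biadditive form and of a biadditive product; the lemmas
  \<open>form_ext_of_lattice\<close> and \<open>prod_ext_of_lattice\<close> below confirm that they restrict to the
  given maps on the lattice.
\<close>

definition form_ext :: "(int ^ 'n \<Rightarrow> int ^ 'n \<Rightarrow> int) \<Rightarrow> complex ^ 'n \<Rightarrow> complex ^ 'n \<Rightarrow> complex" where
  "form_ext q u v = (\<Sum>i\<in>UNIV. \<Sum>j\<in>UNIV. u $ i * v $ j * of_int (q (axis i 1) (axis j 1)))"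

definition prod_ext ::
  "(int ^ 'n \<Rightarrow> int ^ 'n \<Rightarrow> int ^ 'n) \<Rightarrow> complex ^ 'n \<Rightarrow> complex ^ 'n \<Rightarrow> complex ^ 'n" where
  "prod_ext m u v = (\<Sum>i\<in>UNIV. \<Sum>j\<in>UNIV. (u $ i * v $ j) *s of_lattice (m (axis i 1) (axis j 1)))"

definition positive_definite_on ::
  "(complex ^ 'n \<Rightarrow> complex ^ 'n \<Rightarrow> complex) \<Rightarrow> (complex ^ 'n) set \<Rightarrow> bool" where
  "positive_definite_on h U \<longleftrightarrow> (\<forall>u\<in>U. u \<noteq> 0 \<longrightarrow> h u u \<in> \<real> \<and> Re (h u u) > 0)"

text \<open>
  \<open>H p q\<close> is the \<open>(p, q)\<close>-part. That the sum of the three nonzero parts is direct and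
  everything is expressed by bijectivity of the addition map.
\<close>

definition weight2_hodge :: "(int \<Rightarrow> int \<Rightarrow> (complex ^ 'n) set) \<Rightarrow> bool" where
  "weight2_hodge H \<longleftrightarrow>
     (\<forall>p q. vec.subspace (H p q)) \<and>
     (\<forall>p q. (p, q) \<notin> {(2,0), (1,1), (0,2)} \<longrightarrow> H p q = {0}) \<and>
     bij_betw (\<lambda>(a, b, c). a + b + c) (H 2 0 \<times> H 1 1 \<times> H 0 2) UNIV \<and>
     conj_vec ` H 2 0 = H 0 2 \<and>
     conj_vec ` H 1 1 = H 1 1"

definition polarized_weight2_hodge ::
  "(int \<Rightarrow> int \<Rightarrow> (complex ^ 'n) set) \<Rightarrow> (int ^ 'n \<Rightarrow> int ^ 'n \<Rightarrow> int) \<Rightarrow> bool" where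
  "polarized_weight2_hodge H q \<longleftrightarrow>
     weight2_hodge H \<and>
     biadditive q \<and> (\<forall>x y. q x y = q y x) \<and>
     (let h = (\<lambda>\<alpha> \<beta>. form_ext q \<alpha> (conj_vec \<beta>)) in
       (\<forall>p p' r r'. (p, p') \<noteq> (r, r') \<longrightarrow> (\<forall>\<alpha>\<in>H p p'. \<forall>\<beta>\<in>H r r'. h \<alpha> \<beta> = 0)) \<and>
       positive_definite_on h (H 2 0) \<and>
       positive_definite_on h (H 0 2) \<and>
       positive_definite_on (\<lambda>\<alpha> \<beta>. - h \<alpha> \<beta>) (H 1 1))"

text \<open>A weight 1 Hodge structure is given by its \<open>(1, 0)\<close>-part \<open>W\<close>.\<close>

definition weight1_hodge :: "(complex ^ 'n) set \<Rightarrow> bool" where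
  "weight1_hodge W \<longleftrightarrow>
     vec.subspace W \<and> bij_betw (\<lambda>(a, b). a + b) (W \<times> conj_vec ` W) UNIV"

definition polarizable_weight1 :: "(complex ^ 'n) set \<Rightarrow> bool" where
  "polarizable_weight1 W \<longleftrightarrow>
     (\<exists>\<omega> :: int ^ 'n \<Rightarrow> int ^ 'n \<Rightarrow> int.
        biadditive \<omega> \<and> (\<forall>x y. \<omega> x y = - \<omega> y x) \<and>
        (\<forall>w\<in>W. \<forall>w'\<in>W. form_ext \<omega> w w' = 0) \<and>
        positive_definite_on (\<lambda>w w'. \<i> * form_ext \<omega> w (conj_vec w')) W)"

text \<open>
  When \<open>\<complex>\<^sup>n = U \<oplus> C\<close>, \<open>hom_part U C U'\<close> is \<open>Hom(U, U')\<close>, viewed inside the endomorphisms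
  of \<open>\<complex>\<^sup>n\<close> by extending each map by zero on \<open>C\<close>.
\<close>

definition hom_part ::
  "(complex ^ 'n) set \<Rightarrow> (complex ^ 'n) set \<Rightarrow> (complex ^ 'n) set \<Rightarrow> (complex ^ 'n \<Rightarrow> complex ^ 'n) set" where
  "hom_part U C U' =
     {f. Vector_Spaces.linear (*s) (*s) f \<and> f ` U \<subseteq> U' \<and> (\<forall>c\<in>C. f c = 0)}"

definition hom_hodge ::
  "(complex ^ 'n) set \<Rightarrow> int \<Rightarrow> int \<Rightarrow> (complex ^ 'n \<Rightarrow> complex ^ 'n) set" where
  "hom_hodge W p q =
     (let W' = conj_vec ` W in
      if (p, q) = (2, 0) then hom_part W' W W
      else if (p, q) = (1, 1) then {\<lambda>v. f v + g v | f g. f \<in> hom_part W W' W \<and> g \<in> hom_part W' W W'}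
      else if (p, q) = (0, 2) then hom_part W W' W'
      else {\<lambda>v. 0})"

definition unital_ring_on_lattice ::
  "(int ^ 'n \<Rightarrow> int ^ 'n \<Rightarrow> int ^ 'n) \<Rightarrow> int ^ 'n \<Rightarrow> bool" where
  "unital_ring_on_lattice m e \<longleftrightarrow>
     biadditive m \<and>
     (\<forall>x y z. m (m x y) z = m x (m y z)) \<and>
     (\<forall>x. m e x = x \<and> m x e = x)"

definition ring_center :: "('a \<Rightarrow> 'a \<Rightarrow> 'a) \<Rightarrow> 'a set" where
  "ring_center m = {z. \<forall>x. m z x = m x z}"

lemma biadditive_int_expand:
  fixes f :: "int ^ 'n \<Rightarrow> int ^ 'n \<Rightarrow> 'c::real_vector"
  assumes "biadditive f"
  shows "f x y = (\<Sum>i\<in>UNIV. \<Sum>j\<in>UNIV. of_int (x $ i * y $ j) *\<^sub>R f (axis i 1) (axis j 1))"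
proof -
  have scale: "g (k *s z) = of_int k *\<^sub>R g z" if "Modules.additive g" for g :: "int ^ 'n \<Rightarrow> 'c" and k z
  proof (induction k rule: int_induct[of _ 0])
    case base
    show ?case by (simp add: Modules.additive.zero[OF that])
  next
    case (step1 i)
    then show ?case by (simp add: Modules.additive.add[OF that] vector_sadd_rdistrib scaleR_add_left)
  next
    case (step2 i)
    have "(i - 1) *s z = i *s z - z" by (simp add: vec_eq_iff left_diff_distrib)
    with step2 show ?case by (simp add: Modules.additive.diff[OF that] scaleR_diff_left)
  qed
  have expand: "g z = (\<Sum>i\<in>UNIV. of_int (z $ i) *\<^sub>R g (axis i 1))"
    if "Modules.additive g" for g :: "int ^ 'n \<Rightarrow> 'c" and z
  proof -
    have "g z = g (\<Sum>i\<in>UNIV. (z $ i) *s axis i 1)" by (simp add: basis_expansion)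
    also have "\<dots> = (\<Sum>i\<in>UNIV. of_int (z $ i) *\<^sub>R g (axis i 1))"
      by (simp add: Modules.additive.sum[OF that] scale[OF that])
    finally show ?thesis .
  qed
  have "f x y = (\<Sum>i\<in>UNIV. of_int (x $ i) *\<^sub>R f (axis i 1) y)"
    using expand[of "\<lambda>x. f x y" x] assms by (simp add: biadditive_def)
  also have "\<dots> = (\<Sum>i\<in>UNIV. of_int (x $ i) *\<^sub>R (\<Sum>j\<in>UNIV. of_int (y $ j) *\<^sub>R f (axis i 1) (axis j 1)))"
    using expand[of "f (axis _ 1)" y] assms by (simp add: biadditive_def)
  finally show ?thesis by (simp add: scaleR_sum_right)
qed

lemma form_ext_of_lattice:
  assumes "biadditive q"
  shows "form_ext q (of_lattice x) (of_lattice y) = of_int (q x y)"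
proof -
  have "biadditive (\<lambda>x y. of_int (q x y) :: complex)"
    using assms by (simp add: biadditive_def Modules.additive_def)
  from biadditive_int_expand[OF this, of x y] show ?thesis
    by (simp add: form_ext_def of_lattice_def scaleR_conv_of_real)
qed

lemma prod_ext_of_lattice:
  assumes "biadditive m"
  shows "prod_ext m (of_lattice x) (of_lattice y) = of_lattice (m x y)"
proof -
  have "biadditive (\<lambda>x y. of_lattice (m x y))"
    using assms by (simp add: biadditive_def Modules.additive_def of_lattice_def vec_eq_iff)
  from biadditive_int_expand[OF this, of x y] show ?thesis
    by (simp add: prod_ext_def vec_eq_iff of_lattice_def scaleR_conv_of_real[where 'a = complex])
qed

end

theory Submission
  imports Defs
begin

text \<open>
  Put \<open>A = H\<^sub>\<complex>\<close>, graded by \<open>A\<^sub>1 = H\<^sup>2\<^sup>,\<^sup>0\<close>, \<open>A\<^sub>0 = H\<^sup>1\<^sup>,\<^sup>1\<close>, \<open>A\<^sub>-\<^sub>1 = H\<^sup>0\<^sup>,\<^sup>2\<close>. A Hodge structure \<open>W\<close> with the required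
  property satisfies \<open>A\<^sub>1 W = 0\<close> and \<open>A\<^sub>-\<^sub>1 W' = 0\<close> (where \<open>W'\<close> is the conjugate of \<open>W\<close>), so it has to be the
  right annihilator of \<open>A\<^sub>1\<close> as soon as the right annihilators of \<open>A\<^sub>1\<close> and \<open>A\<^sub>-\<^sub>1\<close> are complementary.
  This is the case if the unit lies in \<open>J = A\<^sub>1 A\<^sub>-\<^sub>1 + A\<^sub>-\<^sub>1 A\<^sub>1\<close>, an ideal of \<open>A\<^sub>0\<close>. The polarization is definite
  on \<open>A\<^sub>0\<close>; the component \<open>\<epsilon>\<close> of the unit orthogonal to \<open>J\<close> annihilates \<open>A\<^sub>1\<close> and \<open>A\<^sub>-\<^sub>1\<close>, because
  \<open>\<langle>a\<epsilon>, (a\<epsilon>)\<^sup>-\<rangle> = \<langle>\<epsilon>, t(a) (a\<epsilon>)\<^sup>-\<rangle> = 0\<close>. Hence \<open>\<epsilon>\<close> is a central idempotent fixed by \<open>t\<close>, a multiple of the unit by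
  condition (3), and it vanishes since \<open>A\<^sub>1 \<noteq> 0\<close>.

  Now write the unit as \<open>\<pi> + \<pi>'\<close> with \<open>\<pi> \<in> W\<close> and \<open>\<pi>' \<in> W'\<close>. The real element \<open>l = -i (\<pi>' - \<pi>)\<close> satisfies
  \<open>t(l) = -l\<close>, and \<open>\<langle>x l, y\<rangle>\<close> is a real polarization, as \<open>i l\<close> acts from the right on \<open>W \<subseteq> A\<^sub>1 + A\<^sub>0\<close> by
  \<open>1\<close> on \<open>A\<^sub>1\<close> and by \<open>-1\<close> on \<open>A\<^sub>0\<close>. Positivity is an open condition, so \<open>l\<close> can be
  replaced by a rational skew element, and then by a multiple of it in the lattice.
\<close>

section \<open>Complexification\<close>

lemma conj_vec_simps [simp]:
  "conj_vec (u + v) = conj_vec u + conj_vec v"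
  "conj_vec (u - v) = conj_vec u - conj_vec v"
  "conj_vec (c *s v) = cnj c *s conj_vec v"
  "conj_vec (conj_vec v) = v"
  "conj_vec 0 = 0"
  "conj_vec (of_lattice x) = of_lattice x"
  by (simp_all add: conj_vec_def of_lattice_def vec_eq_iff)

lemma of_lattice_simps:
  "of_lattice (x + y) = of_lattice x + of_lattice y"
  "of_lattice (x - y) = of_lattice x - of_lattice y"
  "of_lattice (k *s x) = of_int k *s of_lattice x"
  by (simp_all add: of_lattice_def vec_eq_iff)

lemma of_lattice_eq_iff [simp]: "of_lattice x = of_lattice y \<longleftrightarrow> x = y"
  by (simp add: of_lattice_def vec_eq_iff)

lemma of_lattice_axis: "of_lattice (axis i 1) = axis i 1"
  by (simp add: of_lattice_def vec_eq_iff axis_def)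

text \<open>The standard basis vectors come from the lattice. This and \<open>linear_map_eqI\<close>
  carry integral identities to the complexification, one variable at a time.\<close>

lemma linear_functional_eqI:
  fixes f g :: "complex ^ 'n \<Rightarrow> complex"
  assumes f: "\<And>x y. f (x + y) = f x + f y" "\<And>c x. f (c *s x) = c * f x"
    and g: "\<And>x y. g (x + y) = g x + g y" "\<And>c x. g (c *s x) = c * g x"
    and eq: "\<And>x. f (of_lattice x) = g (of_lattice x)"
  shows "f v = g v"
proof -
  have expand: "h v = (\<Sum>i\<in>UNIV. v $ i * h (axis i 1))"
    if "\<And>x y. h (x + y) = h x + h y" "\<And>c x. h (c *s x) = c * h x" for h :: "complex ^ 'n \<Rightarrow> complex"
  proof -
    have "h v = h (\<Sum>i\<in>UNIV. (v $ i) *s axis i 1)" by (simp add: basis_expansion)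
    also have "\<dots> = (\<Sum>i\<in>UNIV. h ((v $ i) *s axis i 1))"
      by (rule Modules.additive.sum) (simp add: Modules.additive_def that)
    finally show ?thesis by (simp add: that)
  qed
  show ?thesis
    using expand[of f] expand[of g] f g eq[of "axis _ 1"] by (simp add: of_lattice_axis)
qed

lemma linear_map_eqI:
  fixes f g :: "complex ^ 'n \<Rightarrow> complex ^ 'm"
  assumes "\<And>x y. f (x + y) = f x + f y" "\<And>c x. f (c *s x) = c *s f x"
    and "\<And>x y. g (x + y) = g x + g y" "\<And>c x. g (c *s x) = c *s g x"
    and "\<And>x. f (of_lattice x) = g (of_lattice x)"
  shows "f v = g v"
  unfolding vec_eq_iff
  using linear_functional_eqI[of "\<lambda>v. f v $ _" "\<lambda>v. g v $ _"] assms by simp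

lemma form_ext_simps [simp]:
  "form_ext q (u + v) w = form_ext q u w + form_ext q v w"
  "form_ext q u (v + w) = form_ext q u v + form_ext q u w"
  "form_ext q (u - v) w = form_ext q u w - form_ext q v w"
  "form_ext q u (v - w) = form_ext q u v - form_ext q u w"
  "form_ext q (c *s u) w = c * form_ext q u w"
  "form_ext q u (c *s w) = c * form_ext q u w"
  "form_ext q 0 w = 0"
  "form_ext q u 0 = 0"
  by (simp_all add: form_ext_def algebra_simps sum.distrib sum_subtractf sum_distrib_left)

lemma prod_ext_simps [simp]:
  "prod_ext m (u + v) w = prod_ext m u w + prod_ext m v w"
  "prod_ext m u (v + w) = prod_ext m u v + prod_ext m u w"
  "prod_ext m (u - v) w = prod_ext m u w - prod_ext m v w"
  "prod_ext m u (v - w) = prod_ext m u v - prod_ext m u w"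
  "prod_ext m (c *s u) w = c *s prod_ext m u w"
  "prod_ext m u (c *s w) = c *s prod_ext m u w"
  "prod_ext m 0 w = 0"
  "prod_ext m u 0 = 0"
  by (simp_all add: prod_ext_def vec_eq_iff algebra_simps sum.distrib sum_subtractf sum_distrib_left)

lemma form_ext_conj: "form_ext q (conj_vec u) (conj_vec v) = cnj (form_ext q u v)"
  by (simp add: form_ext_def conj_vec_def)

lemma prod_ext_conj: "prod_ext m (conj_vec u) (conj_vec v) = conj_vec (prod_ext m u v)"
  by (simp add: prod_ext_def conj_vec_def of_lattice_def vec_eq_iff)

lemma linear_prod_ext: "Vector_Spaces.linear (*s) (*s) (prod_ext m u)"
  by (simp add: Vector_Spaces.linear_iff vec.vector_space_axioms)

definition lin_ext :: "(int ^ 'n \<Rightarrow> int ^ 'n) \<Rightarrow> complex ^ 'n \<Rightarrow> complex ^ 'n" where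
  "lin_ext t v = (\<Sum>i\<in>UNIV. (v $ i) *s of_lattice (t (axis i 1)))"

lemma lin_ext_simps [simp]:
  "lin_ext t (u + v) = lin_ext t u + lin_ext t v"
  "lin_ext t (u - v) = lin_ext t u - lin_ext t v"
  "lin_ext t (c *s u) = c *s lin_ext t u"
  "lin_ext t 0 = 0"
  by (simp_all add: lin_ext_def vec_eq_iff algebra_simps sum.distrib sum_subtractf sum_distrib_left)

lemma lin_ext_conj: "lin_ext t (conj_vec u) = conj_vec (lin_ext t u)"
  by (simp add: lin_ext_def conj_vec_def of_lattice_def vec_eq_iff)

lemma lin_ext_of_lattice:
  assumes "Modules.additive t"
  shows "lin_ext t (of_lattice x) = of_lattice (t x)"
proof -
  have scale: "t (k *s y) = k *s t y" for k y
  proof (induction k rule: int_induct[of _ 0])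
    case base
    show ?case by (simp add: Modules.additive.zero[OF assms])
  next
    case (step1 k)
    then show ?case by (simp add: vector_sadd_rdistrib Modules.additive.add[OF assms])
  next
    case (step2 k)
    have "(k - 1) *s y = k *s y - y" for y :: "int ^ 'n"
      by (simp add: vec_eq_iff left_diff_distrib)
    with step2 show ?case by (simp add: Modules.additive.diff[OF assms])
  qed
  have "t x = t (\<Sum>i\<in>UNIV. (x $ i) *s axis i 1)" by (simp add: basis_expansion)
  then have "t x = (\<Sum>i\<in>UNIV. (x $ i) *s t (axis i 1))"
    by (simp add: Modules.additive.sum[OF assms] scale)
  then show ?thesis
    by (simp add: lin_ext_def of_lattice_def vec_eq_iff)
qed

section \<open>Integral linear systems\<close>

text \<open>Over the rationals, \<open>x\<close> extends to a basis of the complex numbers. Applied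
  to coordinates, \<open>\<phi>\<close> turns complex solutions of integral equations into rational
  ones.\<close>

lemma rational_functional_separates:
  assumes "(x :: complex) \<noteq> 0"
  obtains \<phi> :: "complex \<Rightarrow> rat" where "Modules.additive \<phi>" "\<phi> x \<noteq> 0"
proof -
  interpret V: vector_space_pair "\<lambda>(r::rat) (z::complex). of_rat r * z" "(*) :: rat \<Rightarrow> rat \<Rightarrow> rat"
    by unfold_locales (simp_all add: algebra_simps of_rat_add of_rat_mult)
  have "V.vs1.independent {x}"
    using assms by (simp add: V.vs1.independent_insert)
  then obtain \<phi> where lin: "Vector_Spaces.linear (\<lambda>(r::rat) (z::complex). of_rat r * z) (*) \<phi>"
    and "\<phi> x = 1"
    using V.linear_independent_extend[of "{x}" "\<lambda>_. 1"] by auto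
  moreover have "Modules.additive \<phi>"
    using V.linear_add[OF lin] by (simp add: Modules.additive_def)
  ultimately show ?thesis using that by force
qed

lemma rat_vec_common_denominator:
  fixes r :: "'n::finite \<Rightarrow> rat"
  obtains d :: int and x :: "int ^ 'n" where "d \<noteq> 0" "\<And>i. of_int (x $ i) = of_int d * r i"
proof -
  define n d where "n = fst \<circ> quotient_of \<circ> r" and "d = snd \<circ> quotient_of \<circ> r"
  have r: "r i = of_int (n i) / of_int (d i)" and d: "d i > 0" for i
    by (simp_all add: n_def d_def quotient_of_div quotient_of_denom_pos')
  have "of_int ((\<chi> i. n i * (\<Prod>j\<in>UNIV - {i}. d j)) $ i) = of_int (\<Prod>j\<in>UNIV. d j) * r i" for i
    using d[of i] by (simp add: r prod.remove[of UNIV i])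
  moreover have "(\<Prod>j\<in>UNIV. d j) \<noteq> 0" using d by (simp add: less_imp_neq[symmetric])
  ultimately show ?thesis using that by blast
qed

text \<open>Prepares the passage from condition (3), which concerns lattice vectors, to complex
  vectors. If \<open>z\<close> were not proportional to \<open>e\<close>, a rational functional
  applied to each coordinate would give a rational vector that satisfies all integral relations of
  \<open>z\<close> and is still not proportional to \<open>e\<close>; clearing denominators
  contradicts \<open>sol\<close>.\<close>

lemma complex_solution_of_int_system:
  fixes z :: "complex ^ 'n"
  assumes "e \<noteq> 0"
    and sol: "\<And>x :: int ^ 'n. (\<And>c. (\<Sum>i\<in>UNIV. z $ i * of_int (c $ i)) = 0 \<Longrightarrow> (\<Sum>i\<in>UNIV. x $ i * c $ i) = 0)
      \<Longrightarrow> x \<in> range (\<lambda>k. k *s e)"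
  obtains c where "z = c *s of_lattice e"
proof -
  obtain j where j: "e $ j \<noteq> 0" using \<open>e \<noteq> 0\<close> by (auto simp: vec_eq_iff)
  have prop_e: "of_int (e $ j) * z $ i = of_int (e $ i) * z $ j" for i
  proof (rule ccontr)
    assume "of_int (e $ j) * z $ i \<noteq> of_int (e $ i) * z $ j"
    then obtain \<phi> :: "complex \<Rightarrow> rat" where \<phi>: "Modules.additive \<phi>"
      and ne: "\<phi> (of_int (e $ j) * z $ i - of_int (e $ i) * z $ j) \<noteq> 0"
      using rational_functional_separates by (metis right_minus_eq)
    have nat: "\<phi> (of_nat k * y) = of_nat k * \<phi> y" for k y
      by (induction k) (simp_all add: Modules.additive.zero[OF \<phi>] Modules.additive.add[OF \<phi>] algebra_simps)
    have int: "\<phi> (of_int k * y) = of_int k * \<phi> y" for k y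
      using nat[of _ y] Modules.additive.minus[OF \<phi>] by (cases k rule: int_cases2) auto
    have int': "\<phi> (y * of_int k) = of_int k * \<phi> y" for k y
      using int[of k y] by (simp add: mult.commute)
    obtain d :: int and x :: "int ^ 'n" where d: "d \<noteq> 0" and x: "\<And>i. of_int (x $ i) = of_int d * \<phi> (z $ i)"
      by (rule rat_vec_common_denominator[of "\<lambda>i. \<phi> (z $ i)"], rule that)
    have "(\<Sum>i\<in>UNIV. x $ i * c $ i) = 0" if "(\<Sum>i\<in>UNIV. z $ i * of_int (c $ i)) = 0" for c
    proof -
      have "of_int (\<Sum>i\<in>UNIV. x $ i * c $ i) = of_int d * (\<Sum>i\<in>UNIV. \<phi> (z $ i * of_int (c $ i)))"
        by (simp add: x int' sum_distrib_left mult_ac)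
      also have "\<dots> = of_int d * \<phi> (\<Sum>i\<in>UNIV. z $ i * of_int (c $ i))"
        by (simp add: Modules.additive.sum[OF \<phi>])
      also have "\<dots> = 0" by (simp add: that Modules.additive.zero[OF \<phi>])
      finally show ?thesis by (simp only: of_int_eq_0_iff)
    qed
    then obtain k where k: "x = k *s e" using sol by blast
    have "of_int d * \<phi> (of_int (e $ j) * z $ i - of_int (e $ i) * z $ j)
        = of_int (e $ j) * (of_int d * \<phi> (z $ i)) - of_int (e $ i) * (of_int d * \<phi> (z $ j))"
      by (simp only: Modules.additive.diff[OF \<phi>] int right_diff_distrib mult.left_commute)
    also have "\<dots> = 0" by (simp add: x[symmetric] k)
    finally show False using d ne by simp
  qed
  have "z = (z $ j / of_int (e $ j)) *s of_lattice e"
    using prop_e j by (simp add: vec_eq_iff of_lattice_def field_simps)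
  then show ?thesis using that by blast
qed

section \<open>Orthogonal projection\<close>

text \<open>Gram-Schmidt on a finite basis of \<open>J\<close>, with anisotropy on \<open>U\<close>
  in place of positivity, so that it applies to the negative definite form on
  \<open>H 1 1\<close>.\<close>

lemma orthogonal_projection_exists:
  fixes g :: "complex ^ 'n \<Rightarrow> complex ^ 'n \<Rightarrow> complex"
  assumes g: "\<And>x y z. g (x + y) z = g x z + g y z" "\<And>c x z. g (c *s x) z = c * g x z"
      "\<And>x y z. g x (y + z) = g x y + g x z" "\<And>c x z. g x (c *s z) = cnj c * g x z"
    and U: "vec.subspace U" and def: "\<And>x. x \<in> U \<Longrightarrow> g x x = 0 \<Longrightarrow> x = 0"
    and J: "vec.subspace J" "J \<subseteq> U" and "x \<in> U"
  obtains y where "y \<in> J" "\<And>z. z \<in> J \<Longrightarrow> g (x - y) z = 0"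
proof -
  have diff: "g (x - y) z = g x z - g y z" for x y z
    using g(1)[of "x - y" y z] by simp
  have right: "g x z = 0" if "\<And>b. b \<in> B \<Longrightarrow> g x b = 0" "z \<in> vec.span B" for x z B
    using that(2)
  proof (rule vec.span_induct)
    show "vec.subspace {z. g x z = 0}"
      using g(4)[of x 0 0] by (simp add: vec.subspace_def g)
  qed (use that in auto)
  have ex: "\<forall>x. x \<in> U \<longrightarrow> (\<exists>y\<in>vec.span B. \<forall>b\<in>B. g (x - y) b = 0)" if "finite B" "B \<subseteq> U" for B
    using that
  proof (induction B)
    case empty
    show ?case using vec.span_zero by blast
  next
    case (insert b B)
    then obtain p where p: "\<And>x. x \<in> U \<Longrightarrow> p x \<in> vec.span B"
      "\<And>x b. x \<in> U \<Longrightarrow> b \<in> B \<Longrightarrow> g (x - p x) b = 0"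
      by (metis insert_subset)
    have mono: "vec.span B \<subseteq> vec.span (insert b B)" by (rule vec.span_mono) auto
    have spanU: "vec.span B \<subseteq> U" using insert.prems U by (simp add: vec.span_minimal)
    define b' where "b' = b - p b"
    have b': "b' \<in> vec.span (insert b B)" "b' \<in> U"
      using p(1)[of b] mono spanU insert.prems U
      by (auto simp: b'_def vec.span_base intro!: vec.span_diff vec.subspace_diff)
    show ?case
    proof (intro allI impI)
      fix x assume x: "x \<in> U"
      \<comment> \<open>\<open>b'\<close> is \<open>b\<close> made orthogonal to \<open>B\<close>.
        If \<open>g b' b'\<close> is 0, then \<open>b'\<close> is 0 and the correction term
        vanishes.\<close>
      define y where "y = p x + (g (x - p x) b' / g b' b') *s b'"
      have "y \<in> vec.span (insert b B)"
        using p(1)[OF x] mono b' unfolding y_def by (auto intro!: vec.span_add vec.span_scale)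
      moreover have xy: "g (x - y) z = g (x - p x) z - g (x - p x) b' / g b' b' * g b' z" for z
        using g diff by (simp add: y_def)
      have old: "g (x - y) c = 0" if "c \<in> B" for c
        using p(2)[OF x that] p(2)[of b c] that insert.prems by (simp add: xy b'_def)
      have "g (x - y) b' = 0"
        using def[OF b'(2)] g(4)[of "x - p x" 0 0] by (cases "g b' b' = 0") (auto simp: xy)
      moreover have "g (x - y) (p b) = 0"
        using old p(1)[of b] insert.prems right[of B "x - y" "p b"] by simp
      ultimately have "g (x - y) b = 0"
        using g(3)[of "x - y" b' "p b"] by (simp add: b'_def)
      with old \<open>y \<in> _\<close> show "\<exists>y\<in>vec.span (insert b B). \<forall>b\<in>insert b B. g (x - y) b = 0" by blast
    qed
  qed
  obtain B where B: "B \<subseteq> J" "vec.independent B" "J \<subseteq> vec.span B"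
    using vec.maximal_independent_subset[of J] by blast
  have "finite B" using B(2) vec.finiteI_independent by blast
  then obtain y where "y \<in> vec.span B" "\<forall>b\<in>B. g (x - y) b = 0"
    using ex[of B] B(1) J(2) \<open>x \<in> U\<close> by auto
  then have "y \<in> J" "\<And>z. z \<in> J \<Longrightarrow> g (x - y) z = 0"
    using vec.span_minimal[OF B(1) J(1)] right[of B "x - y"] B(3) by auto
  then show ?thesis by (rule that)
qed

section \<open>The graded algebra\<close>

locale hodge_ring =
  fixes H :: "int \<Rightarrow> int \<Rightarrow> (complex ^ 'n) set"
    and q :: "int ^ 'n \<Rightarrow> int ^ 'n \<Rightarrow> int"
    and mult :: "int ^ 'n \<Rightarrow> int ^ 'n \<Rightarrow> int ^ 'n"
    and e :: "int ^ 'n"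
    and t :: "int ^ 'n \<Rightarrow> int ^ 'n"
  assumes pol: "polarized_weight2_hodge H q"
    and nontrivial: "H 2 0 \<noteq> {0}"
    and ring: "unital_ring_on_lattice mult e"
    and bidegree: "\<And>p p' r r' \<alpha> \<beta>. \<alpha> \<in> H p p' \<Longrightarrow> \<beta> \<in> H r r' \<Longrightarrow>
           prod_ext mult \<alpha> \<beta> \<in> H (p + r - 1) (p' + r' - 1)"
    and t_additive: "Modules.additive t"
    and t_t: "\<And>a. t (t a) = a"
    and t_left: "\<And>a x y. q (mult a x) y = q x (mult (t a) y)"
    and t_right: "\<And>a x y. q (mult x a) y = q x (mult y (t a))"
    and center: "{z \<in> ring_center mult. t z = z} = range (\<lambda>k::int. k *s e)"
begin

abbreviation P :: "complex ^ 'n \<Rightarrow> complex ^ 'n \<Rightarrow> complex ^ 'n" (infixl "\<cdot>" 70)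
  where "x \<cdot> y \<equiv> prod_ext mult x y"
abbreviation Q where "Q \<equiv> form_ext q"
abbreviation T where "T \<equiv> lin_ext t"
abbreviation E where "E \<equiv> of_lattice e"

lemma biadd: "biadditive mult" "biadditive q"
  using ring pol by (simp_all add: unital_ring_on_lattice_def polarized_weight2_hodge_def)

lemma assoc: "(x \<cdot> y) \<cdot> z = x \<cdot> (y \<cdot> z)"
proof (rule linear_map_eqI[where v = x])
  fix x show "(of_lattice x \<cdot> y) \<cdot> z = of_lattice x \<cdot> (y \<cdot> z)"
  proof (rule linear_map_eqI[where v = y])
    fix y show "(of_lattice x \<cdot> of_lattice y) \<cdot> z = of_lattice x \<cdot> (of_lattice y \<cdot> z)"
      by (rule linear_map_eqI[where v = z])
        (use ring in \<open>simp_all add: prod_ext_of_lattice[OF biadd(1)] unital_ring_on_lattice_def\<close>)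
  qed simp_all
qed simp_all

lemma unit [simp]: "E \<cdot> x = x" "x \<cdot> E = x"
proof -
  show "E \<cdot> x = x"
    by (rule linear_map_eqI[where v = x])
      (use ring in \<open>simp_all add: prod_ext_of_lattice[OF biadd(1)] unital_ring_on_lattice_def\<close>)
  show "x \<cdot> E = x"
    by (rule linear_map_eqI[where v = x])
      (use ring in \<open>simp_all add: prod_ext_of_lattice[OF biadd(1)] unital_ring_on_lattice_def\<close>)
qed

lemma Q_sym: "Q x y = Q y x"
  using pol by (simp add: form_ext_def polarized_weight2_hodge_def mult_ac)
    (subst sum.swap, simp add: mult_ac)

lemma Q_left: "Q (a \<cdot> x) y = Q x (T a \<cdot> y)"
proof (rule linear_functional_eqI[where v = a])
  fix a show "Q (of_lattice a \<cdot> x) y = Q x (T (of_lattice a) \<cdot> y)"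
  proof (rule linear_functional_eqI[where v = x])
    fix x show "Q (of_lattice a \<cdot> of_lattice x) y = Q (of_lattice x) (T (of_lattice a) \<cdot> y)"
      by (rule linear_functional_eqI[where v = y])
        (simp_all add: prod_ext_of_lattice[OF biadd(1)] form_ext_of_lattice[OF biadd(2)]
          lin_ext_of_lattice[OF t_additive] t_left)
  qed simp_all
qed simp_all

lemma Q_right: "Q (x \<cdot> a) y = Q x (y \<cdot> T a)"
proof (rule linear_functional_eqI[where v = a])
  fix a show "Q (x \<cdot> of_lattice a) y = Q x (y \<cdot> T (of_lattice a))"
  proof (rule linear_functional_eqI[where v = x])
    fix x show "Q (of_lattice x \<cdot> of_lattice a) y = Q (of_lattice x) (y \<cdot> T (of_lattice a))"
      by (rule linear_functional_eqI[where v = y])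
        (simp_all add: prod_ext_of_lattice[OF biadd(1)] form_ext_of_lattice[OF biadd(2)]
          lin_ext_of_lattice[OF t_additive] t_right)
  qed simp_all
qed simp_all

lemma T_T [simp]: "T (T x) = x"
  by (rule linear_map_eqI[where v = x]) (simp_all add: lin_ext_of_lattice[OF t_additive] t_t)

lemma hodge: "weight2_hodge H"
  using pol by (simp add: polarized_weight2_hodge_def)

lemma subspace_H: "vec.subspace (H p p')"
  using hodge by (simp add: weight2_hodge_def)

lemma H_closed [simp]:
  "0 \<in> H p p'"
  "x \<in> H p p' \<Longrightarrow> y \<in> H p p' \<Longrightarrow> x + y \<in> H p p'"
  "x \<in> H p p' \<Longrightarrow> y \<in> H p p' \<Longrightarrow> x - y \<in> H p p'"
  "x \<in> H p p' \<Longrightarrow> c *s x \<in> H p p'"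
  using subspace_H[of p p']
  by (simp_all add: vec.subspace_0 vec.subspace_add vec.subspace_diff vec.subspace_scale)

lemma hodge_decomposition:
  obtains a b c where "x = a + b + c" "a \<in> H 2 0" "b \<in> H 1 1" "c \<in> H 0 2"
proof -
  have "x \<in> (\<lambda>(a, b, c). a + b + c) ` (H 2 0 \<times> H 1 1 \<times> H 0 2)"
    using hodge by (simp add: weight2_hodge_def bij_betw_def)
  then show ?thesis using that by auto
qed

lemma hodge_components_eq:
  assumes "a + b + c = a' + b' + c'" "a \<in> H 2 0" "b \<in> H 1 1" "c \<in> H 0 2"
    "a' \<in> H 2 0" "b' \<in> H 1 1" "c' \<in> H 0 2"
  shows "a = a'" "b = b'" "c = c'"
proof -
  have "inj_on (\<lambda>(a, b, c). a + b + c) (H 2 0 \<times> H 1 1 \<times> H 0 2)"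
    using hodge by (simp add: weight2_hodge_def bij_betw_def)
  from inj_onD[OF this, of "(a, b, c)" "(a', b', c')"] assms
  show "a = a'" "b = b'" "c = c'" by auto
qed

lemma hodge_components_eq_0:
  assumes "a + b + c = 0" "a \<in> H 2 0" "b \<in> H 1 1" "c \<in> H 0 2"
  shows "a = 0" "b = 0" "c = 0"
  using hodge_components_eq[of a b c 0 0 0] assms by auto

lemma conj_H:
  "x \<in> H 2 0 \<Longrightarrow> conj_vec x \<in> H 0 2"
  "x \<in> H 1 1 \<Longrightarrow> conj_vec x \<in> H 1 1"
  "x \<in> H 0 2 \<Longrightarrow> conj_vec x \<in> H 2 0"
proof -
  have eq: "conj_vec ` H 2 0 = H 0 2" "conj_vec ` H 1 1 = H 1 1"
    using hodge by (simp_all add: weight2_hodge_def)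
  show "x \<in> H 2 0 \<Longrightarrow> conj_vec x \<in> H 0 2" "x \<in> H 1 1 \<Longrightarrow> conj_vec x \<in> H 1 1"
    using eq by blast+
  show "conj_vec x \<in> H 2 0" if "x \<in> H 0 2"
  proof -
    obtain y where "x = conj_vec y" "y \<in> H 2 0" using \<open>x \<in> H 0 2\<close> eq by blast
    then show ?thesis by simp
  qed
qed

lemma H_zero: "(p, p') \<notin> {(2,0), (1,1), (0,2)} \<Longrightarrow> x \<in> H p p' \<Longrightarrow> x = 0"
  using hodge by (auto simp: weight2_hodge_def)

lemma prod_zero:
  "x \<in> H 2 0 \<Longrightarrow> y \<in> H 2 0 \<Longrightarrow> x \<cdot> y = 0"
  "x \<in> H 0 2 \<Longrightarrow> y \<in> H 0 2 \<Longrightarrow> x \<cdot> y = 0"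
  using bidegree[of x 2 0 y 2 0] bidegree[of x 0 2 y 0 2]
    H_zero[of 3 "-1" "x \<cdot> y"] H_zero[of "-1" 3 "x \<cdot> y"] by simp_all

lemma prod_H:
  "x \<in> H 2 0 \<Longrightarrow> y \<in> H 1 1 \<Longrightarrow> x \<cdot> y \<in> H 2 0"
  "x \<in> H 2 0 \<Longrightarrow> y \<in> H 0 2 \<Longrightarrow> x \<cdot> y \<in> H 1 1"
  "x \<in> H 1 1 \<Longrightarrow> y \<in> H 2 0 \<Longrightarrow> x \<cdot> y \<in> H 2 0"
  "x \<in> H 1 1 \<Longrightarrow> y \<in> H 1 1 \<Longrightarrow> x \<cdot> y \<in> H 1 1"
  "x \<in> H 1 1 \<Longrightarrow> y \<in> H 0 2 \<Longrightarrow> x \<cdot> y \<in> H 0 2"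
  "x \<in> H 0 2 \<Longrightarrow> y \<in> H 2 0 \<Longrightarrow> x \<cdot> y \<in> H 1 1"
  "x \<in> H 0 2 \<Longrightarrow> y \<in> H 1 1 \<Longrightarrow> x \<cdot> y \<in> H 0 2"
  using bidegree[of x 2 0 y 1 1] bidegree[of x 2 0 y 0 2] bidegree[of x 1 1 y 2 0]
    bidegree[of x 1 1 y 1 1] bidegree[of x 1 1 y 0 2] bidegree[of x 0 2 y 2 0]
    bidegree[of x 0 2 y 1 1] by simp_all

lemma orth: "x \<in> H p p' \<Longrightarrow> y \<in> H r r' \<Longrightarrow> (p, p') \<noteq> (r, r') \<Longrightarrow> Q x (conj_vec y) = 0"
  using pol unfolding polarized_weight2_hodge_def Let_def by blast

lemma Q_orth:
  "x \<in> H 2 0 \<Longrightarrow> y \<in> H 2 0 \<Longrightarrow> Q x y = 0"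
  "x \<in> H 2 0 \<Longrightarrow> y \<in> H 1 1 \<Longrightarrow> Q x y = 0"
  "x \<in> H 1 1 \<Longrightarrow> y \<in> H 2 0 \<Longrightarrow> Q x y = 0"
  "x \<in> H 1 1 \<Longrightarrow> y \<in> H 0 2 \<Longrightarrow> Q x y = 0"
  "x \<in> H 0 2 \<Longrightarrow> y \<in> H 1 1 \<Longrightarrow> Q x y = 0"
  "x \<in> H 0 2 \<Longrightarrow> y \<in> H 0 2 \<Longrightarrow> Q x y = 0"
  using orth[of x _ _ "conj_vec y"] conj_H[of y] by fastforce+

lemma Q_pos:
  "x \<in> H 2 0 \<Longrightarrow> x \<noteq> 0 \<Longrightarrow> Re (Q x (conj_vec x)) > 0"
  "x \<in> H 0 2 \<Longrightarrow> x \<noteq> 0 \<Longrightarrow> Re (Q x (conj_vec x)) > 0"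
  "x \<in> H 1 1 \<Longrightarrow> x \<noteq> 0 \<Longrightarrow> Re (Q x (conj_vec x)) < 0"
  using pol unfolding polarized_weight2_hodge_def positive_definite_on_def Let_def by force+

lemma Q_definite:
  "x \<in> H 2 0 \<union> H 1 1 \<union> H 0 2 \<Longrightarrow> Q x (conj_vec x) = 0 \<Longrightarrow> x = 0"
  using Q_pos[of x] by force

text \<open>Pairing \<open>y\<close> with the conjugate of one of its Hodge components isolates that
  component, and the hermitian form is definite there.\<close>

lemma Q_nondegenerate:
  assumes "\<And>x. Q x y = 0" shows "y = 0"
proof -
  obtain a b c where y: "y = a + b + c" and H: "a \<in> H 2 0" "b \<in> H 1 1" "c \<in> H 0 2"
    by (rule hodge_decomposition)
  have "a = 0" "b = 0" "c = 0"
    using assms[of "conj_vec a"] assms[of "conj_vec b"] assms[of "conj_vec c"] H conj_H Q_definite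
    by (auto simp: y Q_orth Q_sym[of "conj_vec _"])
  then show ?thesis by (simp add: y)
qed

text \<open>\<open>t\<close> is only assumed additive; adjointness makes it reverse products. Moving
  \<open>a \<cdot> b\<close> across the form at once or one factor at a time gives the same pairing
  with every \<open>x\<close>.\<close>

lemma T_mult: "T (a \<cdot> b) = T b \<cdot> T a"
proof -
  have "Q x (T (a \<cdot> b) - T b \<cdot> T a) = 0" for x
    using Q_left[of "a \<cdot> b" x E] Q_left[of a "b \<cdot> x" E] Q_left[of b x "T a"] by (simp add: assoc)
  then show ?thesis using Q_nondegenerate by fastforce
qed

lemma T_E [simp]: "T E = E"
  using T_mult[of E "T E"] by simp

text \<open>The (2,0)-components of \<open>E \<cdot> a = a\<close> and
  \<open>b \<cdot> E = b\<close> give \<open>b \<cdot> a = a\<close> and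
  \<open>b \<cdot> a = 0\<close>. So \<open>a\<close> vanishes, and so does \<open>c\<close>, its
  conjugate because the unit is real.\<close>

lemma E_H: "E \<in> H 1 1"
proof -
  obtain a b c where E: "E = a + b + c" and H: "a \<in> H 2 0" "b \<in> H 1 1" "c \<in> H 0 2"
    by (rule hodge_decomposition)
  have "E = conj_vec c + conj_vec b + conj_vec a"
    by (metis E conj_vec_simps(1,6) add.commute add.assoc)
  then have c: "c = conj_vec a"
    using hodge_components_eq(3)[of a b c "conj_vec c" "conj_vec b" "conj_vec a"] E H conj_H by simp
  have "a = b \<cdot> a + c \<cdot> a + 0"
    using unit(1)[of a] unfolding E by (simp add: prod_zero H)
  then have ba: "b \<cdot> a = a"
    using hodge_components_eq(1)[of "b \<cdot> a" "c \<cdot> a" 0 a 0 0] H prod_H by simp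
  have "b = b \<cdot> a + b \<cdot> b + b \<cdot> c"
    using unit(2)[of b] unfolding E by simp
  then have "b \<cdot> a = 0"
    using hodge_components_eq(1)[of "b \<cdot> a" "b \<cdot> b" "b \<cdot> c" 0 b 0] H prod_H by simp
  then show ?thesis using ba c E H by simp
qed

text \<open>Adjointness gives \<open>Q x (T a) = Q (a \<cdot> x) E\<close>. For \<open>x\<close> of
  type (1,1) or (2,0) the product \<open>a \<cdot> x\<close> has no (1,1)-part, hence is orthogonal
  to the unit; this removes the other components of \<open>T a\<close>.\<close>

lemma T_H20: "T a \<in> H 2 0" if a: "a \<in> H 2 0"
proof -
  obtain a' b c where Ta: "T a = a' + b + c" and H: "a' \<in> H 2 0" "b \<in> H 1 1" "c \<in> H 0 2"
    by (rule hodge_decomposition)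
  have "a \<cdot> conj_vec b \<in> H 2 0" "a \<cdot> conj_vec c = 0"
    using prod_H(1) prod_zero(1) a H conj_H by simp_all
  then have "Q (conj_vec b) (T a) = 0" "Q (conj_vec c) (T a) = 0"
    using Q_left[of a "conj_vec b" E] Q_left[of a "conj_vec c" E] E_H Q_orth by simp_all
  then have "b = 0" "c = 0"
    using H conj_H Q_definite by (auto simp: Ta Q_orth Q_sym[of "conj_vec _"])
  then show ?thesis using Ta H by simp
qed

lemma T_H02: "T c \<in> H 0 2" if "c \<in> H 0 2"
  using T_H20[of "conj_vec c"] conj_H[of c] conj_H(1)[of "T (conj_vec c)"] that
  by (simp add: lin_ext_conj)

section \<open>The central idempotent orthogonal to the outer part\<close>

text \<open>A two-sided ideal of the ring \<open>H 1 1\<close>, see \<open>H11_inner20\<close>. The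
  order of the factors matters: \<open>inner02\<close> is the opposite product, and the ideal
  \<open>J\<close> of the overview is the sum of the two.\<close>

definition inner20 where "inner20 = vec.span {a \<cdot> c | a c. a \<in> H 2 0 \<and> c \<in> H 0 2}"
definition inner02 where "inner02 = vec.span {c \<cdot> a | a c. a \<in> H 2 0 \<and> c \<in> H 0 2}"

lemma inner20_induct [consumes 1, case_names subspace prod]:
  assumes "x \<in> inner20" "vec.subspace (Collect R)" "\<And>a c. a \<in> H 2 0 \<Longrightarrow> c \<in> H 0 2 \<Longrightarrow> R (a \<cdot> c)"
  shows "R x"
  using vec.span_induct[of x "{a \<cdot> c | a c. a \<in> H 2 0 \<and> c \<in> H 0 2}" R] assms
  unfolding inner20_def by blast

lemma inner02_induct [consumes 1, case_names subspace prod]: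
  assumes "x \<in> inner02" "vec.subspace (Collect R)" "\<And>a c. a \<in> H 2 0 \<Longrightarrow> c \<in> H 0 2 \<Longrightarrow> R (c \<cdot> a)"
  shows "R x"
  using vec.span_induct[of x "{c \<cdot> a | a c. a \<in> H 2 0 \<and> c \<in> H 0 2}" R] assms
  unfolding inner02_def by blast

lemma subspace_inner: "vec.subspace inner20" "vec.subspace inner02"
  by (simp_all add: inner20_def inner02_def)

lemma inner_base:
  "a \<in> H 2 0 \<Longrightarrow> c \<in> H 0 2 \<Longrightarrow> a \<cdot> c \<in> inner20"
  "a \<in> H 2 0 \<Longrightarrow> c \<in> H 0 2 \<Longrightarrow> c \<cdot> a \<in> inner02"
  unfolding inner20_def inner02_def by (auto intro!: vec.span_base)

lemma inner20_H: "x \<in> inner20 \<Longrightarrow> x \<in> H 1 1"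
  by (induction rule: inner20_induct) (simp_all add: subspace_H prod_H)

lemma inner02_H: "x \<in> inner02 \<Longrightarrow> x \<in> H 1 1"
  by (induction rule: inner02_induct) (simp_all add: subspace_H prod_H)

lemma inner20_kills: "x \<in> inner20 \<Longrightarrow> \<forall>c\<in>H 0 2. c \<cdot> y = 0 \<Longrightarrow> x \<cdot> y = 0"
  by (induction rule: inner20_induct) (simp_all add: vec.subspace_def assoc)

lemma inner02_kills: "x \<in> inner02 \<Longrightarrow> \<forall>a\<in>H 2 0. a \<cdot> y = 0 \<Longrightarrow> x \<cdot> y = 0"
  by (induction rule: inner02_induct) (simp_all add: vec.subspace_def assoc)

lemma inner20_killed: "x \<in> inner20 \<Longrightarrow> \<forall>a\<in>H 2 0. y \<cdot> a = 0 \<Longrightarrow> y \<cdot> x = 0"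
  by (induction rule: inner20_induct) (simp_all add: vec.subspace_def assoc[symmetric])

lemma inner02_killed: "x \<in> inner02 \<Longrightarrow> \<forall>c\<in>H 0 2. y \<cdot> c = 0 \<Longrightarrow> y \<cdot> x = 0"
  by (induction rule: inner02_induct) (simp_all add: vec.subspace_def assoc[symmetric])

lemma T_inner20: "x \<in> inner20 \<Longrightarrow> T x \<in> inner02"
  by (induction rule: inner20_induct)
    (use subspace_inner in \<open>simp_all add: vec.subspace_def T_mult inner_base T_H20 T_H02\<close>)

lemma T_inner02: "x \<in> inner02 \<Longrightarrow> T x \<in> inner20"
  by (induction rule: inner02_induct)
    (use subspace_inner in \<open>simp_all add: vec.subspace_def T_mult inner_base T_H20 T_H02\<close>)

lemma H11_inner20:
  assumes "b \<in> H 1 1"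
  shows "x \<in> inner20 \<Longrightarrow> b \<cdot> x \<in> inner20" "x \<in> inner20 \<Longrightarrow> x \<cdot> b \<in> inner20"
  subgoal by (induction rule: inner20_induct)
    (use subspace_inner assms in \<open>simp_all add: vec.subspace_def assoc[symmetric] inner_base prod_H\<close>)
  subgoal by (induction rule: inner20_induct)
    (use subspace_inner assms in \<open>simp_all add: vec.subspace_def assoc inner_base prod_H\<close>)
  done

lemma H11_inner02:
  assumes "b \<in> H 1 1"
  shows "x \<in> inner02 \<Longrightarrow> b \<cdot> x \<in> inner02" "x \<in> inner02 \<Longrightarrow> x \<cdot> b \<in> inner02"
  subgoal by (induction rule: inner02_induct)
    (use subspace_inner assms in \<open>simp_all add: vec.subspace_def assoc[symmetric] inner_base prod_H\<close>)
  subgoal by (induction rule: inner02_induct)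
    (use subspace_inner assms in \<open>simp_all add: vec.subspace_def assoc inner_base prod_H\<close>)
  done

text \<open>Condition (3) after extension of scalars. Commuting with lattice elements and being
  fixed by \<open>t\<close> are linear equations with integral coefficients.\<close>

lemma T_fixed_central:
  assumes comm: "\<And>x. z \<cdot> x = x \<cdot> z" and Tz: "T z = z"
  obtains k where "z = k *s E"
proof (rule complex_solution_of_int_system[of e z])
  obtain a where "a \<in> H 2 0" "a \<noteq> 0" using nontrivial H_closed(1) by blast
  then show "e \<noteq> 0" using unit(1)[of a] by (auto simp: of_lattice_def zero_vec_def[symmetric])
next
  fix x :: "int ^ 'n"
  assume rel: "\<And>c. (\<Sum>i\<in>UNIV. z $ i * of_int (c $ i)) = 0 \<Longrightarrow> (\<Sum>i\<in>UNIV. x $ i * c $ i) = 0"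
  \<comment> \<open>Agreement of two integral endomorphisms at \<open>z\<close> is one integral
    relation per coordinate, so \<open>rel\<close> passes it on to \<open>x\<close>.\<close>
  have integral: "f x = g x" if "lin_ext f z = lin_ext g z" "Modules.additive f" "Modules.additive g"
    for f g :: "int ^ 'n \<Rightarrow> int ^ 'n"
  proof -
    have "(\<Sum>i\<in>UNIV. x $ i * (\<chi> i. f (axis i 1) $ k - g (axis i 1) $ k) $ i) = 0" for k
      using that(1)
      by (intro rel) (simp add: lin_ext_def vec_eq_iff of_lattice_def algebra_simps sum_subtractf)
    then have "of_int (\<Sum>i\<in>UNIV. x $ i * (f (axis i 1) $ k - g (axis i 1) $ k)) = (0 :: complex)" for k
      by (subst of_int_eq_0_iff) simp
    then have "lin_ext f (of_lattice x) = lin_ext g (of_lattice x)"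
      by (simp add: lin_ext_def vec_eq_iff of_lattice_def algebra_simps sum_subtractf)
    then show ?thesis by (simp add: lin_ext_of_lattice that)
  qed
  have add: "Modules.additive (\<lambda>x. mult x y)" "Modules.additive (\<lambda>x. mult y x)" for y
    using biadd(1) by (simp_all add: biadditive_def)
  have left: "lin_ext (\<lambda>x. mult x y) v = v \<cdot> of_lattice y" for v y
    by (rule linear_map_eqI[where v = v])
      (simp_all add: lin_ext_of_lattice add prod_ext_of_lattice[OF biadd(1)])
  have right: "lin_ext (mult y) v = of_lattice y \<cdot> v" for v y
    by (rule linear_map_eqI[where v = v])
      (simp_all add: lin_ext_of_lattice add prod_ext_of_lattice[OF biadd(1)])
  have "mult x y = mult y x" for y
    using integral[of "\<lambda>x. mult x y" "mult y"] comm add by (simp add: left right)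
  moreover have "t x = x"
  proof -
    have "Modules.additive (\<lambda>x :: int ^ 'n. x)" by (simp add: Modules.additive_def)
    moreover have "lin_ext (\<lambda>x. x) z = z"
      by (simp add: lin_ext_def of_lattice_axis basis_expansion)
    ultimately show ?thesis using integral[of t "\<lambda>x. x"] t_additive Tz by simp
  qed
  ultimately show "x \<in> range (\<lambda>k. k *s e)"
    using center by (auto simp: ring_center_def)
qed (rule that)

definition W10 where "W10 = {x. \<forall>a\<in>H 2 0. a \<cdot> x = 0}"
definition W01 where "W01 = {x. \<forall>c\<in>H 0 2. c \<cdot> x = 0}"

text \<open>Left multiplication by the two summands will give the projections onto
  \<open>W10\<close> and \<open>W01\<close>.\<close>

lemma unit_decomposition:
  obtains p p' where "p \<in> inner20" "p' \<in> inner02" "E = p + p'"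
proof -
  define J where "J = {x + y | x y. x \<in> inner20 \<and> y \<in> inner02}"
  have J: "vec.subspace J"
    unfolding J_def using subspace_inner by (rule vec.subspace_sums)
  have inJ: "x \<in> inner20 \<Longrightarrow> x \<in> J" "x \<in> inner02 \<Longrightarrow> x \<in> J" for x
    unfolding J_def using vec.subspace_0[OF subspace_inner(1)] vec.subspace_0[OF subspace_inner(2)]
    by force+
  have JH: "J \<subseteq> H 1 1" using inner20_H inner02_H by (auto simp: J_def)
  obtain j where j: "j \<in> J" and jperp: "\<And>z. z \<in> J \<Longrightarrow> Q (E - j) (conj_vec z) = 0"
    by (rule orthogonal_projection_exists[of "\<lambda>x y. Q x (conj_vec y)" "H 1 1" J E])
      (use J JH E_H subspace_H Q_definite in auto)
  define \<epsilon> where "\<epsilon> = E - j"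
  have \<epsilon>H: "\<epsilon> \<in> H 1 1" using E_H j JH by (auto simp: \<epsilon>_def)
  have perp: "Q \<epsilon> x = 0" if "conj_vec x \<in> J" for x using jperp[OF that] by (simp add: \<epsilon>_def)
  have left: "\<epsilon> \<cdot> a = 0" "a \<cdot> \<epsilon> = 0" if a: "a \<in> H 2 0" for a
  proof -
    \<comment> \<open>The adjunction moves \<open>a\<close> to the second argument, and
      \<open>perp\<close> applies once the conjugate of that argument is seen to lie in
      \<open>J\<close>.\<close>
    have "conj_vec (T a \<cdot> conj_vec (a \<cdot> \<epsilon>)) = conj_vec (T a) \<cdot> (a \<cdot> \<epsilon>)"
      by (simp add: prod_ext_conj[symmetric])
    also have "\<dots> = (conj_vec (T a) \<cdot> a) \<cdot> \<epsilon>" by (simp add: assoc)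
    also have "\<dots> \<in> J" using a \<epsilon>H by (intro inJ H11_inner02 inner_base conj_H T_H20)
    finally have "Q (a \<cdot> \<epsilon>) (conj_vec (a \<cdot> \<epsilon>)) = 0" using perp by (simp add: Q_left)
    then show "a \<cdot> \<epsilon> = 0" using prod_H(1)[OF a \<epsilon>H] Q_definite by blast
    have "conj_vec (conj_vec (\<epsilon> \<cdot> a) \<cdot> T a) = (\<epsilon> \<cdot> a) \<cdot> conj_vec (T a)"
      by (simp add: prod_ext_conj[symmetric])
    also have "\<dots> = \<epsilon> \<cdot> (a \<cdot> conj_vec (T a))" by (simp add: assoc)
    also have "\<dots> \<in> J" using a \<epsilon>H by (intro inJ H11_inner20 inner_base conj_H T_H20)
    finally have "Q (\<epsilon> \<cdot> a) (conj_vec (\<epsilon> \<cdot> a)) = 0" using perp by (simp add: Q_right)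
    then show "\<epsilon> \<cdot> a = 0" using prod_H(3)[OF \<epsilon>H a] Q_definite by blast
  qed
  have right: "\<epsilon> \<cdot> c = 0" "c \<cdot> \<epsilon> = 0" if c: "c \<in> H 0 2" for c
  proof -
    have "conj_vec (T c \<cdot> conj_vec (c \<cdot> \<epsilon>)) = conj_vec (T c) \<cdot> (c \<cdot> \<epsilon>)"
      by (simp add: prod_ext_conj[symmetric])
    also have "\<dots> = (conj_vec (T c) \<cdot> c) \<cdot> \<epsilon>" by (simp add: assoc)
    also have "\<dots> \<in> J" using c \<epsilon>H by (intro inJ H11_inner20 inner_base conj_H T_H02)
    finally have "Q (c \<cdot> \<epsilon>) (conj_vec (c \<cdot> \<epsilon>)) = 0" using perp by (simp add: Q_left)
    then show "c \<cdot> \<epsilon> = 0" using prod_H(7)[OF c \<epsilon>H] Q_definite by blast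
    have "conj_vec (conj_vec (\<epsilon> \<cdot> c) \<cdot> T c) = (\<epsilon> \<cdot> c) \<cdot> conj_vec (T c)"
      by (simp add: prod_ext_conj[symmetric])
    also have "\<dots> = \<epsilon> \<cdot> (c \<cdot> conj_vec (T c))" by (simp add: assoc)
    also have "\<dots> \<in> J" using c \<epsilon>H by (intro inJ H11_inner02 inner_base conj_H T_H02)
    finally have "Q (\<epsilon> \<cdot> c) (conj_vec (\<epsilon> \<cdot> c)) = 0" using perp by (simp add: Q_right)
    then show "\<epsilon> \<cdot> c = 0" using prod_H(5)[OF \<epsilon>H c] Q_definite by blast
  qed
  \<comment> \<open>The generators of \<open>J\<close> begin and end with a factor from
    \<open>H 2 0\<close> or \<open>H 0 2\<close>, which \<open>\<epsilon>\<close>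
    annihilates.\<close>
  have \<epsilon>J: "\<epsilon> \<cdot> x = 0" "x \<cdot> \<epsilon> = 0" if "x \<in> J" for x
    using that left right inner20_kills inner02_kills inner20_killed inner02_killed
    unfolding J_def by auto
  have ideal: "b \<cdot> x \<in> J" "x \<cdot> b \<in> J" if "x \<in> J" "b \<in> H 1 1" for x b
    using that H11_inner20[OF that(2)] H11_inner02[OF that(2)] unfolding J_def by fastforce+
  have E: "E = j + \<epsilon>" by (simp add: \<epsilon>_def)
  \<comment> \<open>Both sides equal \<open>\<epsilon> \<cdot> b \<cdot> \<epsilon>\<close>: insert
    the unit as \<open>j + \<epsilon>\<close> and drop the terms in the ideal \<open>J\<close>,
    which \<open>\<epsilon>\<close> kills.\<close>
  have comm11: "\<epsilon> \<cdot> b = b \<cdot> \<epsilon>" if b: "b \<in> H 1 1" for b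
  proof -
    have "\<epsilon> \<cdot> b = (\<epsilon> \<cdot> b) \<cdot> (j + \<epsilon>)" by (simp flip: E)
    also have "\<dots> = (\<epsilon> \<cdot> b) \<cdot> \<epsilon>" using \<epsilon>J(1)[OF ideal(1)[OF j b]] by (simp add: assoc)
    also have "\<dots> = (j + \<epsilon>) \<cdot> (b \<cdot> \<epsilon>)" using \<epsilon>J(2)[OF ideal(2)[OF j b]] by (simp add: assoc[symmetric])
    also have "\<dots> = b \<cdot> \<epsilon>" by (simp flip: E)
    finally show ?thesis .
  qed
  have comm: "\<epsilon> \<cdot> x = x \<cdot> \<epsilon>" for x
    by (rule hodge_decomposition[of x]) (simp add: left right comm11)
  have "T j \<in> J"
  proof -
    obtain x y where "j = x + y" "x \<in> inner20" "y \<in> inner02" using j by (auto simp: J_def)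
    then have "T j = T y + T x" "T y \<in> inner20" "T x \<in> inner02"
      by (simp_all add: T_inner20 T_inner02)
    then show ?thesis unfolding J_def by blast
  qed
  moreover have "E = T j + T \<epsilon>" using arg_cong[OF E, of T] by simp
  \<comment> \<open>Multiply the last equation by \<open>\<epsilon>\<close> on the left. The
    resulting product \<open>\<epsilon> \<cdot> T \<epsilon>\<close> is fixed by \<open>T\<close>,
    hence so is \<open>\<epsilon>\<close>.\<close>
  ultimately have "\<epsilon> = \<epsilon> \<cdot> T \<epsilon>"
    using \<epsilon>J(1)[of "T j"] unit(2)[of \<epsilon>] by simp
  then have "T \<epsilon> = \<epsilon>" using T_mult[of \<epsilon> "T \<epsilon>"] by simp
  with comm obtain k where k: "\<epsilon> = k *s E" by (rule T_fixed_central)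
  obtain a where "a \<in> H 2 0" "a \<noteq> 0" using nontrivial H_closed(1) by blast
  then have "k = 0" using left(1)[of a] by (simp add: k)
  then have "E \<in> J" using j E k by simp
  then show ?thesis using that unfolding J_def by blast
qed

section \<open>The weight one Hodge structure\<close>

text \<open>The choice is harmless: by \<open>inner_W\<close> and \<open>W_sum_unique\<close> there
  is only one such splitting of the unit.\<close>

definition proj10 where "proj10 = (SOME p. p \<in> inner20 \<and> E - p \<in> inner02)"
definition proj01 where "proj01 = E - proj10"

lemma proj_inner: "proj10 \<in> inner20" "proj01 \<in> inner02"
proof -
  have "\<exists>p. p \<in> inner20 \<and> E - p \<in> inner02"
    using unit_decomposition by (metis add_diff_cancel_left')
  from someI_ex[OF this] show "proj10 \<in> inner20" "proj01 \<in> inner02"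
    by (simp_all add: proj10_def proj01_def)
qed

lemma proj_sum: "proj10 \<cdot> x + proj01 \<cdot> x = x" "x \<cdot> proj10 + x \<cdot> proj01 = x"
  by (simp_all add: proj01_def)

lemma subspace_W: "vec.subspace W10" "vec.subspace W01"
  by (simp_all add: W10_def W01_def vec.subspace_def)

lemma proj_kills: "x \<in> W01 \<Longrightarrow> proj10 \<cdot> x = 0" "x \<in> W10 \<Longrightarrow> proj01 \<cdot> x = 0"
  using proj_inner inner20_kills inner02_kills by (auto simp: W01_def W10_def)

text \<open>\<open>proj10\<close> kills \<open>W01\<close>, \<open>proj01\<close> kills
  \<open>W10\<close>, and their sum is the unit.\<close>

lemma W_Int: "x \<in> W10 \<Longrightarrow> x \<in> W01 \<Longrightarrow> x = 0"
  using proj_sum(1)[of x] proj_kills by simp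

lemma prod_W:
  "a \<in> H 2 0 \<Longrightarrow> a \<cdot> x \<in> W10" "c \<in> H 0 2 \<Longrightarrow> c \<cdot> x \<in> W01"
  "b \<in> H 1 1 \<Longrightarrow> w \<in> W10 \<Longrightarrow> b \<cdot> w \<in> W10" "b \<in> H 1 1 \<Longrightarrow> w \<in> W01 \<Longrightarrow> b \<cdot> w \<in> W01"
  by (simp_all add: W10_def W01_def assoc[symmetric] prod_zero prod_H)

lemma W_right: "w \<in> W10 \<Longrightarrow> w \<cdot> x \<in> W10" "w \<in> W01 \<Longrightarrow> w \<cdot> x \<in> W01"
  by (simp_all add: W10_def W01_def assoc[symmetric])

lemma inner_W: "x \<in> inner20 \<Longrightarrow> x \<in> W10" "y \<in> inner02 \<Longrightarrow> y \<in> W01"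
  subgoal by (induction rule: inner20_induct) (simp_all add: subspace_W prod_W)
  subgoal by (induction rule: inner02_induct) (simp_all add: subspace_W prod_W)
  done

lemma proj_W: "proj10 \<cdot> x \<in> W10" "proj01 \<cdot> x \<in> W01"
  using proj_inner inner_W W_right by simp_all

text \<open>A single linear equation for \<open>W10\<close>, from which its closedness is read off
  later.\<close>

lemma W10_iff: "x \<in> W10 \<longleftrightarrow> proj01 \<cdot> x = 0"
  using proj_kills proj_sum(1)[of x] proj_W(1)[of x] by fastforce

lemma W_sum_unique:
  assumes "u + v = u' + v'" "u \<in> W10" "u' \<in> W10" "v \<in> W01" "v' \<in> W01"
  shows "u = u'" "v = v'"
proof -
  have "u - u' = v' - v" using assms(1) by (simp add: algebra_simps)
  moreover have "u - u' \<in> W10" "v' - v \<in> W01"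
    using assms subspace_W by (simp_all add: vec.subspace_diff)
  ultimately have "u - u' = 0" using W_Int by metis
  then show "u = u'" "v = v'" using \<open>u - u' = v' - v\<close> by simp_all
qed

lemma conj_W: "conj_vec x \<in> W01 \<longleftrightarrow> x \<in> W10"
proof
  assume x: "conj_vec x \<in> W01"
  have "a \<cdot> x = 0" if "a \<in> H 2 0" for a
  proof -
    have "a \<cdot> x = conj_vec (conj_vec a \<cdot> conj_vec x)" by (simp add: prod_ext_conj)
    then show ?thesis using x that conj_H by (simp add: W01_def)
  qed
  then show "x \<in> W10" by (simp add: W10_def)
next
  assume x: "x \<in> W10"
  have "c \<cdot> conj_vec x = 0" if "c \<in> H 0 2" for c
  proof -
    have "c \<cdot> conj_vec x = conj_vec (conj_vec c \<cdot> x)" by (simp add: prod_ext_conj[symmetric])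
    then show ?thesis using x that conj_H by (simp add: W10_def)
  qed
  then show "conj_vec x \<in> W01" by (simp add: W01_def)
qed

lemma conj_W10: "conj_vec ` W10 = W01"
  using conj_W by (auto simp: image_iff) (metis conj_vec_simps(4))

text \<open>The unit is real and conjugation exchanges \<open>W10\<close> and \<open>W01\<close>, so
  conjugating its splitting gives the same splitting with the summands exchanged.\<close>

lemma conj_proj: "conj_vec proj10 = proj01"
proof (rule W_sum_unique(2))
  show "conj_vec proj01 + conj_vec proj10 = proj10 + proj01"
    by (simp add: proj01_def)
  show "conj_vec proj01 \<in> W10"
    using conj_W[of "conj_vec proj01"] inner_W proj_inner by simp
qed (use conj_W inner_W proj_inner in auto)

text \<open>The same uniqueness argument, now with \<open>T\<close> fixing the unit and exchanging
  \<open>inner20\<close> and \<open>inner02\<close>.\<close>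

lemma T_proj: "T proj10 = proj01"
proof (rule W_sum_unique(2))
  show "T proj01 + T proj10 = proj10 + proj01"
    by (simp add: proj01_def)
qed (use inner_W proj_inner T_inner20 T_inner02 in auto)

lemma weight1_W10: "weight1_hodge W10"
proof -
  have "inj_on (\<lambda>(a, b). a + b) (W10 \<times> W01)"
    by (rule inj_onI) (auto dest: W_sum_unique)
  moreover have "x \<in> (\<lambda>(a, b). a + b) ` (W10 \<times> W01)" for x
    by (rule image_eqI[of _ _ "(proj10 \<cdot> x, proj01 \<cdot> x)"]) (simp_all only: split proj_sum proj_W mem_Times_iff fst_conv snd_conv)
  then have "(\<lambda>(a, b). a + b) ` (W10 \<times> W01) = UNIV" by blast
  ultimately show ?thesis
    using subspace_W by (simp add: weight1_hodge_def conj_W10 bij_betw_def)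
qed

section \<open>Compatibility with left multiplication, and uniqueness\<close>

lemma left_mult_hom:
  assumes "\<alpha> \<in> H p p'"
  shows "prod_ext mult \<alpha> \<in> hom_hodge W10 p p'"
proof -
  consider "p = 2" "p' = 0" | "p = 1" "p' = 1" | "p = 0" "p' = 2" | "(p, p') \<notin> {(2,0), (1,1), (0,2)}"
    by auto
  then show ?thesis
  proof cases
    case 1
    then show ?thesis using assms linear_prod_ext prod_W
      by (auto simp: hom_hodge_def hom_part_def conj_W10 W10_def)
  next
    case 3
    then show ?thesis using assms linear_prod_ext prod_W
      by (auto simp: hom_hodge_def hom_part_def conj_W10 W01_def)
  next
    case 2
    \<comment> \<open>Elements of type (1,1) preserve both summands; composing with the two
      projections gives the diagonal blocks, each zero on the other summand.\<close>
    have "(\<lambda>v. \<alpha> \<cdot> (proj10 \<cdot> v)) \<in> hom_part W10 W01 W10" "(\<lambda>v. \<alpha> \<cdot> (proj01 \<cdot> v)) \<in> hom_part W01 W10 W01"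
      using assms 2 linear_prod_ext[of mult "\<alpha> \<cdot> _"] prod_W proj_W proj_kills
      by (auto simp: hom_part_def assoc[symmetric]) (simp_all add: assoc)
    moreover have "prod_ext mult \<alpha> = (\<lambda>v. \<alpha> \<cdot> (proj10 \<cdot> v) + \<alpha> \<cdot> (proj01 \<cdot> v))"
      by (simp add: fun_eq_iff proj_sum flip: prod_ext_simps(2))
    ultimately have "prod_ext mult \<alpha> \<in> {\<lambda>v. f v + g v | f g. f \<in> hom_part W10 W01 W10 \<and> g \<in> hom_part W01 W10 W01}"
      by (intro CollectI exI conjI)
    then show ?thesis using 2 unfolding hom_hodge_def conj_W10 Let_def by simp
  next
    case 4
    then have "\<alpha> = 0" using assms by (rule H_zero)
    with 4 show ?thesis by (auto simp: hom_hodge_def fun_eq_iff)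
  qed
qed

text \<open>The (2,0)-condition puts \<open>W\<close> inside \<open>W10\<close>, so its conjugate
  lies inside \<open>W01\<close>. Two direct decompositions nested in this way coincide.\<close>

lemma W10_unique:
  assumes "weight1_hodge W" and hom: "\<And>p p' \<alpha>. \<alpha> \<in> H p p' \<Longrightarrow> prod_ext mult \<alpha> \<in> hom_hodge W p p'"
  shows "W = W10"
proof
  have "prod_ext mult a \<in> hom_part (conj_vec ` W) W W" if "a \<in> H 2 0" for a
    using hom[OF that] by (simp add: hom_hodge_def Let_def)
  then show sub: "W \<subseteq> W10" by (auto simp: W10_def hom_part_def)
  show "W10 \<subseteq> W"
  proof
    fix x assume x: "x \<in> W10"
    have "x \<in> (\<lambda>(a, b). a + b) ` (W \<times> conj_vec ` W)"
      using assms(1) by (simp add: weight1_hodge_def bij_betw_def)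
    then obtain u v where uv: "u \<in> W" "v \<in> W" "x = u + conj_vec v" by auto
    then have "x = u"
      using W_sum_unique(1)[of u "conj_vec v" x 0] x sub conj_W subspace_W vec.subspace_0 by auto
    then show "x \<in> W" using uv by simp
  qed
qed

end

section \<open>The polarization\<close>

lemma tendsto_floor_scaled:
  "(\<lambda>k. real_of_int \<lfloor>real k * x\<rfloor> / real k) \<longlonglongrightarrow> x"
proof -
  have "(\<lambda>k. real_of_int \<lfloor>real k * x\<rfloor> / real k - x) \<longlonglongrightarrow> 0"
  proof (rule Lim_null_comparison)
    have "\<bar>real_of_int \<lfloor>real k * x\<rfloor> / real k - x\<bar> \<le> 1 / real k" if "k > 0" for k :: nat
    proof -
      have "real_of_int \<lfloor>real k * x\<rfloor> / real k - x = (real_of_int \<lfloor>real k * x\<rfloor> - real k * x) / real k"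
        using that by (simp add: field_simps)
      moreover have "\<bar>real_of_int \<lfloor>real k * x\<rfloor> - real k * x\<bar> \<le> 1" by linarith
      ultimately show ?thesis using that by (simp add: divide_right_mono)
    qed
    then show "\<forall>\<^sub>F k in sequentially. norm (real_of_int \<lfloor>real k * x\<rfloor> / real k - x) \<le> 1 / real k"
      by (auto intro: eventually_mono[OF eventually_gt_at_top[of 0]])
  qed (rule lim_1_over_n)
  then show ?thesis by (simp add: LIM_zero_iff)
qed

lemma tendsto_form_ext [tendsto_intros]:
  "(f \<longlongrightarrow> u) F \<Longrightarrow> (g \<longlongrightarrow> v) F \<Longrightarrow> ((\<lambda>x. form_ext q (f x) (g x)) \<longlongrightarrow> form_ext q u v) F"
  unfolding form_ext_def by (intro tendsto_intros)

lemma tendsto_prod_ext [tendsto_intros]: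
  "(f \<longlongrightarrow> u) F \<Longrightarrow> (g \<longlongrightarrow> v) F \<Longrightarrow> ((\<lambda>x. prod_ext m (f x) (g x)) \<longlongrightarrow> prod_ext m u v) F"
  unfolding prod_ext_def by (rule vec_tendstoI) (simp, intro tendsto_intros)

lemma tendsto_conj_vec [tendsto_intros]:
  "(f \<longlongrightarrow> u) F \<Longrightarrow> ((\<lambda>x. conj_vec (f x)) \<longlongrightarrow> conj_vec u) F"
  unfolding conj_vec_def by (rule vec_tendstoI) (simp, intro tendsto_intros)

lemma tendsto_lin_ext [tendsto_intros]:
  "(f \<longlongrightarrow> u) F \<Longrightarrow> ((\<lambda>x. lin_ext t (f x)) \<longlongrightarrow> lin_ext t u) F"
  unfolding lin_ext_def by (rule vec_tendstoI) (simp, intro tendsto_intros)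

section \<open>Positivity of the twisted form\<close>

context hodge_ring
begin

text \<open>The element \<open>l\<close> of the overview. Conjugation and \<open>T\<close> both
  exchange the projectors; the factor \<open>- \<i>\<close> makes their difference real, while
  \<open>T\<close> changes its sign.\<close>

definition twist :: "complex ^ 'n" where "twist = (- \<i>) *s (proj01 - proj10)"
text \<open>The real part of the diagonal of the hermitian form attached to the candidate
  polarization \<open>Q (x \<cdot> l) y\<close>.\<close>

definition energy :: "complex ^ 'n \<Rightarrow> complex ^ 'n \<Rightarrow> real"
  where "energy l w = Re (\<i> * Q (w \<cdot> l) (conj_vec w))"

lemma conj_proj': "conj_vec proj01 = proj10"
  using conj_proj by (metis conj_vec_simps(4))

lemma T_proj': "T proj01 = proj10"
  using T_proj by (metis T_T)

lemma conj_twist: "conj_vec twist = twist"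
  by (simp add: twist_def conj_proj conj_proj' vec_eq_iff algebra_simps)

lemma T_twist: "T twist = - twist"
  by (simp add: twist_def T_proj T_proj' vec_eq_iff algebra_simps)

text \<open>Multiplication by \<open>H 2 0\<close> shifts the type, so each component of
  \<open>w\<close> is annihilated separately. The (0,2)-component lies in \<open>W01\<close> as well
  and vanishes.\<close>

lemma W10_components:
  assumes "w \<in> W10"
  obtains a b where "w = a + b" "a \<in> H 2 0" "b \<in> H 1 1" "b \<in> W10"
proof -
  obtain a b c where w: "w = a + b + c" and H: "a \<in> H 2 0" "b \<in> H 1 1" "c \<in> H 0 2"
    by (rule hodge_decomposition)
  have *: "x \<cdot> b = 0 \<and> x \<cdot> c = 0" if x: "x \<in> H 2 0" for x
  proof -
    have "x \<cdot> b + x \<cdot> c + 0 = 0" using assms x H by (simp add: W10_def w prod_zero)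
    then show ?thesis
      using hodge_components_eq_0[of "x \<cdot> b" "x \<cdot> c" 0] prod_H x H by simp
  qed
  then have "b \<in> W10" "c \<in> W10" by (simp_all add: W10_def)
  moreover have "c \<in> W01" using H by (simp add: W01_def prod_zero)
  ultimately show ?thesis using that w H W_Int by force
qed

text \<open>Right multiplication by \<open>proj01 - proj10\<close> fixes \<open>a\<close> and
  negates \<open>b\<close>. The energy is thus the polarization at \<open>a\<close> minus that at
  \<open>b\<close>, and the signs on \<open>H 2 0\<close> and \<open>H 1 1\<close> make both terms
  nonnegative.\<close>

lemma energy_twist_pos:
  assumes "w \<in> W10" "w \<noteq> 0" shows "energy twist w > 0"
proof -
  obtain a b where w: "w = a + b" and H: "a \<in> H 2 0" "b \<in> H 1 1" "b \<in> W10"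
    using assms(1) by (rule W10_components)
  have a: "a \<cdot> proj10 = 0"
    using inner20_killed[OF proj_inner(1)] H(1) prod_zero(1) by blast
  \<comment> \<open>\<open>b\<close> preserves \<open>W01\<close> because of its type, and
    \<open>W10\<close> is a right ideal, so the product lies in both.\<close>
  have "b \<cdot> proj01 \<in> W01" using prod_W(4)[OF H(2)] inner_W(2)[OF proj_inner(2)] by blast
  moreover have "b \<cdot> proj01 \<in> W10" using W_right(1)[OF H(3)] by blast
  ultimately have b: "b \<cdot> proj01 = 0" using W_Int by blast
  have "w \<cdot> (proj01 - proj10) = a - b"
    using proj_sum(2)[of a] proj_sum(2)[of b] a b by (simp add: w)
  then have "\<i> * Q (w \<cdot> twist) (conj_vec w) = Q (a - b) (conj_vec a + conj_vec b)"
    unfolding twist_def by (simp only: prod_ext_simps(6) form_ext_simps(5) w conj_vec_simps) simp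
  also have "\<dots> = Q a (conj_vec a) - Q b (conj_vec b)"
    using H conj_H Q_orth by simp
  finally have "energy twist w = Re (Q a (conj_vec a)) - Re (Q b (conj_vec b))"
    by (simp add: energy_def)
  moreover have "Re (Q a (conj_vec a)) \<ge> 0" "Re (Q b (conj_vec b)) \<le> 0"
    using Q_pos(1)[of a] Q_pos(3)[of b] H by (cases "a = 0"; cases "b = 0"; force)+
  moreover have "a \<noteq> 0 \<or> b \<noteq> 0" using assms(2) w by auto
  ultimately show ?thesis
    using Q_pos(1)[of a] Q_pos(3)[of b] H by force
qed

text \<open>The first rule clears denominators in \<open>l\<close>, the second reduces positivity to
  the unit sphere.\<close>

lemma energy_scale:
  "energy (complex_of_real r *s l) w = r * energy l w"
  "energy l (complex_of_real r *s w) = r\<^sup>2 * energy l w"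
  by (simp_all add: energy_def power2_eq_square algebra_simps)

text \<open>If every approximation failed at some point of the compact set \<open>K\<close>, a limit
  of such points would have nonpositive energy for \<open>twist\<close>.\<close>

lemma skew_lattice_element_exists:
  obtains l where "t l = - l" "\<And>w. w \<in> W10 \<Longrightarrow> w \<noteq> 0 \<Longrightarrow> energy (of_lattice l) w > 0"
proof -
  define f :: "nat \<Rightarrow> int ^ 'n" where "f k = (\<chi> i. \<lfloor>real k * Re (twist $ i)\<rfloor>)" for k
  \<comment> \<open>Subtracting the image under \<open>t\<close> makes the rounded vector skew; as
    \<open>twist\<close> is skew already, the limit is merely doubled.\<close>
  define s where "s k = f k - t (f k)" for k
  define v where "v k = complex_of_real (1 / real k) *s of_lattice (s k)" for k
  define K where "K = W10 \<inter> sphere 0 1"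
  have "compact K"
  proof -
    have "W10 = {x. proj01 \<cdot> x = 0}" using W10_iff by blast
    moreover have "continuous_on UNIV (\<lambda>x. proj01 \<cdot> x)"
      unfolding continuous_on_def by (intro ballI tendsto_intros)
    ultimately have "closed W10" by (simp add: closed_Collect_eq)
    then show ?thesis unfolding K_def by (intro closed_Int_compact compact_sphere)
  qed
  have t_s: "t (s k) = - s k" for k
    by (simp add: s_def Modules.additive.diff[OF t_additive] t_t)
  have "(\<lambda>k. complex_of_real (1 / real k) *s of_lattice (f k)) \<longlonglongrightarrow> twist"
  proof (rule vec_tendstoI)
    fix i
    have "twist $ i = complex_of_real (Re (twist $ i))"
      using conj_twist by (simp add: vec_eq_iff conj_vec_def complex_eq_iff)
    moreover have "(\<lambda>k. complex_of_real (real_of_int \<lfloor>real k * Re (twist $ i)\<rfloor> / real k))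
        \<longlonglongrightarrow> complex_of_real (Re (twist $ i))"
      by (intro tendsto_intros tendsto_floor_scaled)
    ultimately show "(\<lambda>k. (complex_of_real (1 / real k) *s of_lattice (f k)) $ i) \<longlonglongrightarrow> twist $ i"
      by (simp add: f_def of_lattice_def)
  qed
  then have "(\<lambda>k. complex_of_real (1 / real k) *s of_lattice (f k)
      - T (complex_of_real (1 / real k) *s of_lattice (f k))) \<longlonglongrightarrow> twist - T twist"
    by (intro tendsto_intros)
  moreover have "v = (\<lambda>k. complex_of_real (1 / real k) *s of_lattice (f k)
      - T (complex_of_real (1 / real k) *s of_lattice (f k)))"
    by (simp add: v_def s_def of_lattice_simps lin_ext_of_lattice[OF t_additive]
        fun_eq_iff vec_eq_iff diff_divide_distrib)
  moreover have "twist - T twist = complex_of_real 2 *s twist"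
    by (simp add: T_twist vec_eq_iff)
  ultimately have v: "v \<longlonglongrightarrow> complex_of_real 2 *s twist" by simp
  have "\<exists>k. \<forall>w\<in>K. energy (of_lattice (s k)) w > 0"
  proof (rule ccontr)
    assume "\<nexists>k. \<forall>w\<in>K. energy (of_lattice (s k)) w > 0"
    then obtain w where wK: "\<And>k. w k \<in> K" and w: "\<And>k. energy (of_lattice (s k)) (w k) \<le> 0"
      by (metis not_less)
    obtain x r where x: "x \<in> K" and r: "strict_mono r" "(w \<circ> r) \<longlonglongrightarrow> x"
      using \<open>compact K\<close> wK unfolding compact_def by metis
    have "energy (v k) (w k) \<le> 0" for k
      unfolding v_def energy_scale using w[of k] by (intro mult_nonneg_nonpos) auto
    moreover have "(\<lambda>k. energy (v (r k)) (w (r k))) \<longlonglongrightarrow> energy (complex_of_real 2 *s twist) x"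
      using r(2) LIMSEQ_subseq_LIMSEQ[OF v r(1)] unfolding energy_def o_def
      by (intro tendsto_intros)
    ultimately have "energy (complex_of_real 2 *s twist) x \<le> 0"
      by (intro LIMSEQ_le_const2) auto
    moreover have "energy twist x > 0" using x by (intro energy_twist_pos) (auto simp: K_def)
    ultimately show False unfolding energy_scale by simp
  qed
  then obtain k where k: "\<And>w. w \<in> K \<Longrightarrow> energy (of_lattice (s k)) w > 0" by blast
  have "energy (of_lattice (s k)) w > 0" if w: "w \<in> W10" "w \<noteq> 0" for w
  proof -
    define u where "u = complex_of_real (1 / norm w) *s w"
    have "u = (1 / norm w) *\<^sub>R w" by (simp add: u_def vec_eq_iff scaleR_conv_of_real[where 'a = complex])
    then have "norm u = 1" using w by simp
    moreover have "u \<in> W10" unfolding u_def using w subspace_W(1) by (intro vec.subspace_scale)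
    ultimately have "u \<in> K" by (simp add: K_def)
    from k[OF this] show ?thesis
      using w unfolding u_def energy_scale by (simp add: zero_less_mult_iff)
  qed
  with t_s show ?thesis by (rule that)
qed

text \<open>\<open>t l = - l\<close> makes the twisted form skew, and \<open>l\<close> in the
  lattice keeps it integral.\<close>

lemma polarizable_W10: "polarizable_weight1 W10"
proof -
  obtain l where tl: "t l = - l" and pos: "\<And>w. w \<in> W10 \<Longrightarrow> w \<noteq> 0 \<Longrightarrow> energy (of_lattice l) w > 0"
    by (rule skew_lattice_element_exists) blast
  define \<omega> where "\<omega> x y = q (mult x l) y" for x y
  have bi: "biadditive \<omega>"
    using biadd by (simp add: biadditive_def \<omega>_def Modules.additive_def)
  have skew: "\<omega> x y = - \<omega> y x" for x y
  proof -
    have "\<omega> x y = q x (mult y (- l))" by (simp add: \<omega>_def t_right tl)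
    also have "\<dots> = - q x (mult y l)"
      using biadd by (simp add: biadditive_def Modules.additive.minus)
    also have "\<dots> = - \<omega> y x" using pol by (simp add: \<omega>_def polarized_weight2_hodge_def)
    finally show ?thesis .
  qed
  have ext: "form_ext \<omega> u v = Q (u \<cdot> of_lattice l) v" for u v
  proof (rule linear_functional_eqI[where v = u])
    fix x show "form_ext \<omega> (of_lattice x) v = Q (of_lattice x \<cdot> of_lattice l) v"
      by (rule linear_functional_eqI[where v = v])
        (simp_all add: form_ext_of_lattice[OF bi] form_ext_of_lattice[OF biadd(2)]
          prod_ext_of_lattice[OF biadd(1)], simp add: \<omega>_def)
  qed simp_all
  have skew_ext: "form_ext \<omega> u v = - form_ext \<omega> v u" for u v
  proof (rule linear_functional_eqI[where v = u])
    fix x show "form_ext \<omega> (of_lattice x) v = - form_ext \<omega> v (of_lattice x)"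
      by (rule linear_functional_eqI[where v = v])
        (simp_all add: form_ext_of_lattice[OF bi], metis skew of_int_minus)
  qed simp_all
  have isotropic: "form_ext \<omega> w w' = 0" if "w \<in> W10" "w' \<in> W10" for w w'
  proof -
    let ?x = "w \<cdot> of_lattice l"
    \<comment> \<open>\<open>W10\<close> is a right ideal on which \<open>proj10\<close> acts as the
      identity. Its adjoint is \<open>proj01\<close>, which kills \<open>w'\<close>.\<close>
    have "proj10 \<cdot> ?x = ?x" using proj_sum(1)[of ?x] proj_kills(2)[OF W_right(1)[OF that(1)]] by simp
    then have "Q ?x w' = Q ?x (proj01 \<cdot> w')" using Q_left[of proj10 ?x w'] by (simp add: T_proj)
    then show ?thesis using proj_kills(2)[OF that(2)] by (simp add: ext)
  qed
  have "positive_definite_on (\<lambda>w w'. \<i> * form_ext \<omega> w (conj_vec w')) W10"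
    unfolding positive_definite_on_def
  proof (intro ballI impI conjI)
    fix u assume u: "u \<in> W10" "u \<noteq> 0"
    \<comment> \<open>Conjugation exchanges the two arguments; the sign from skewness cancels the
      sign of \<open>cnj \<i>\<close>.\<close>
    have "cnj (form_ext \<omega> u (conj_vec u)) = form_ext \<omega> (conj_vec u) u"
      using form_ext_conj[of \<omega> u "conj_vec u"] by simp
    then have "cnj (\<i> * form_ext \<omega> u (conj_vec u)) = \<i> * form_ext \<omega> u (conj_vec u)"
      using skew_ext[of "conj_vec u" u] by simp
    then show "\<i> * form_ext \<omega> u (conj_vec u) \<in> \<real>" by (simp only: Reals_cnj_iff)
    show "Re (\<i> * form_ext \<omega> u (conj_vec u)) > 0" using pos[OF u] by (simp only: ext energy_def)
  qed
  with bi skew isotropic show ?thesis unfolding polarizable_weight1_def by blast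
qed

end

theorem theorem1:
  fixes H :: "int \<Rightarrow> int \<Rightarrow> (complex ^ 'n) set"
    and q :: "int ^ 'n \<Rightarrow> int ^ 'n \<Rightarrow> int"
    and mult :: "int ^ 'n \<Rightarrow> int ^ 'n \<Rightarrow> int ^ 'n"
    and e :: "int ^ 'n"
    and t :: "int ^ 'n \<Rightarrow> int ^ 'n"
  assumes "polarized_weight2_hodge H q"
    and "H 2 0 \<noteq> {0}"
    and "unital_ring_on_lattice mult e"
    and "\<And>p p' r r' \<alpha> \<beta>. \<alpha> \<in> H p p' \<Longrightarrow> \<beta> \<in> H r r' \<Longrightarrow>
           prod_ext mult \<alpha> \<beta> \<in> H (p + r - 1) (p' + r' - 1)"
    and "Modules.additive t"
    and "\<And>a. t (t a) = a"
    and "\<And>a x y. q (mult a x) y = q x (mult (t a) y)"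
    and "\<And>a x y. q (mult x a) y = q x (mult y (t a))"
    and "{z \<in> ring_center mult. t z = z} = range (\<lambda>k::int. k *s e)"
  shows "\<exists>!W :: (complex ^ 'n) set.
           weight1_hodge W \<and> polarizable_weight1 W \<and>
           (\<forall>p p'. \<forall>\<alpha>\<in>H p p'. prod_ext mult \<alpha> \<in> hom_hodge W p p')"
proof -
  interpret hodge_ring H q mult e t
    by (rule hodge_ring.intro; fact)
  show ?thesis
    using weight1_W10 polarizable_W10 left_mult_hom W10_unique by (intro ex1I[of _ W10]) blast+
qed

end
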